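(* For any integers $k,n\geq 1$ and $m>2$, there exists a cyclic $(C_{4k}\times P_m)$-decomposition of each of the following complete multipartite graphs: $K_{(4k+1)\times 2(2m-1)n}$, $K_{(2k+1)\times 4(2m-1)n}$, and $K_{(k+1)\times 8(2m-1)n}$.
   Context: $C_r$ ($r\ge 3$) is the cycle on $r$ vertices and $P_m$ ($m\ge 2$) is the path on $m$ vertices. $C_r\times P_m$ denotes their Cartesian product (the grid on a cylinder): its vertices are the pairs $(i,j)$ with $1\le i\le m$, $1\le j\le r$, and its edges are $[(i,j),(i,j+1)]$ (with $j$ taken modulo $r$) for $1\le i\le m$, and $[(i,j),(i+1,j)]$ for $1\le i\le m-1$. $K_{s\times t}$ denotes the complete $s$-partite graph with all parts of size $t$. Given a subgraph $\Gamma$ of a graph $K$, a $\Gamma$-decomposition of $K$ is a set of subgraphs of $K$ (called blocks), each isomorphic to $\Gamma$, whose edge-sets partition the edge-set of $K$. Such a decomposition is cyclic if it is invariant under a cyclic permutation of all vertices of $K$, i.e. there is a permutation of $V(K)$ consisting of a single cycle of length $|V(K)|$ which maps the set of blocks onto itself. *)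

theory Defs
  imports "HOL-Library.Disjoint_Sets" "HOL-Combinatorics.Combinatorics"
begin

text \<open>
  Undirected graphs with edges as two-element vertex sets, so that one edge is one object
  and ``the edge-sets partition the edge-set'' can be stated verbatim.
\<close>

record 'a ugraph =
  verts :: "'a set"
  edges :: "'a set set"

definition simple_graph :: "'a ugraph \<Rightarrow> bool" where
  "simple_graph G \<longleftrightarrow> edges G \<subseteq> {{u, v} | u v. u \<in> verts G \<and> v \<in> verts G \<and> u \<noteq> v}"

definition subgraph :: "'a ugraph \<Rightarrow> 'a ugraph \<Rightarrow> bool" where
  "subgraph H G \<longleftrightarrow> simple_graph H \<and> simple_graph G \<and> verts H \<subseteq> verts G \<and> edges H \<subseteq> edges G"

definition isomorphic :: "'a ugraph \<Rightarrow> 'b ugraph \<Rightarrow> bool" where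
  "isomorphic G H \<longleftrightarrow> (\<exists>f. bij_betw f (verts G) (verts H) \<and>
     (\<forall>u\<in>verts G. \<forall>v\<in>verts G. {u, v} \<in> edges G \<longleftrightarrow> {f u, f v} \<in> edges H))"

definition map_ugraph :: "('a \<Rightarrow> 'b) \<Rightarrow> 'a ugraph \<Rightarrow> 'b ugraph" where
  "map_ugraph f G = \<lparr>verts = f ` verts G, edges = (\<lambda>e. f ` e) ` edges G\<rparr>"

text \<open>
  \<open>j\<close> ranges over \<open>{1..r}\<close>, so the successor of \<open>j\<close> modulo \<open>r\<close> in this range is \<open>j mod r + 1\<close>.
\<close>

definition cylinder :: "nat \<Rightarrow> nat \<Rightarrow> (nat \<times> nat) ugraph" where
  "cylinder r m = \<lparr>verts = {1..m} \<times> {1..r},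
     edges = {{(i, j), (i, j mod r + 1)} | i j. 1 \<le> i \<and> i \<le> m \<and> 1 \<le> j \<and> j \<le> r}
           \<union> {{(i, j), (i + 1, j)} | i j. 1 \<le> i \<and> i < m \<and> 1 \<le> j \<and> j \<le> r}\<rparr>"

text \<open>\<open>K\<^sub>s\<^sub>\<times>\<^sub>t\<close>; the first component of a vertex names its part.\<close>

definition complete_multipartite :: "nat \<Rightarrow> nat \<Rightarrow> (nat \<times> nat) ugraph" where
  "complete_multipartite s t = \<lparr>verts = {..<s} \<times> {..<t},
     edges = {{u, v} | u v. u \<in> {..<s} \<times> {..<t} \<and> v \<in> {..<s} \<times> {..<t} \<and> fst u \<noteq> fst v}\<rparr>"

text \<open>
  Disjointness is required of the family indexed by the blocks (not just of the set of
  edge-sets), so two different blocks cannot share an edge-set containing an edge.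
\<close>

definition is_decomposition :: "'b ugraph \<Rightarrow> 'a ugraph \<Rightarrow> 'a ugraph set \<Rightarrow> bool" where
  "is_decomposition \<Gamma> K \<B> \<longleftrightarrow>
     (\<forall>B\<in>\<B>. subgraph B K \<and> isomorphic \<Gamma> B) \<and>
     disjoint_family_on edges \<B> \<and> (\<Union>B\<in>\<B>. edges B) = edges K"

definition is_cyclic_decomposition :: "'b ugraph \<Rightarrow> 'a ugraph \<Rightarrow> 'a ugraph set \<Rightarrow> bool" where
  "is_cyclic_decomposition \<Gamma> K \<B> \<longleftrightarrow> is_decomposition \<Gamma> K \<B> \<and>
     (\<exists>\<sigma>. \<sigma> permutes verts K \<and> cyclic_on \<sigma> (verts K) \<and> map_ugraph \<sigma> ` \<B> = \<B>)"

lemma simple_graph_cylinder: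
  assumes "r \<ge> 2"
  shows "simple_graph (cylinder r m)"
proof -
  let ?P = "{{u, v} | u v. u \<in> {1..m} \<times> {1..r} \<and> v \<in> {1..m} \<times> {1..r} \<and> u \<noteq> v}"
  have pair: "{u, v} \<in> ?P" if "u \<in> {1..m} \<times> {1..r}" "v \<in> {1..m} \<times> {1..r}" "u \<noteq> v" for u v
    using that by blast
  have "{(i, j), (i, j mod r + 1)} \<in> ?P"
    if ij: "1 \<le> i" "i \<le> m" "1 \<le> j" "j \<le> r" for i j
  proof (rule pair)
    show "(i, j) \<in> {1..m} \<times> {1..r}" using ij by simp
    have "j mod r + 1 \<le> r" using assms mod_less_divisor[of r j] by linarith
    then show "(i, j mod r + 1) \<in> {1..m} \<times> {1..r}" using ij by simp
    show "(i, j) \<noteq> (i, j mod r + 1)" using ij assms by (cases "j = r") simp_all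
  qed
  moreover have "{(i, j), (i + 1, j)} \<in> ?P"
    if ij: "1 \<le> i" "i < m" "1 \<le> j" "j \<le> r" for i j
  proof (rule pair)
    show "(i, j) \<in> {1..m} \<times> {1..r}" using ij by simp
    show "(i + 1, j) \<in> {1..m} \<times> {1..r}" using ij by simp
  qed simp
  ultimately have "edges (cylinder r m) \<subseteq> ?P"
    unfolding cylinder_def ugraph.simps by (intro Un_least subsetI; elim CollectE exE conjE; simp only:)
  then show ?thesis
    by (simp add: simple_graph_def cylinder_def)
qed

lemma simple_graph_complete_multipartite: "simple_graph (complete_multipartite s t)"
  unfolding simple_graph_def complete_multipartite_def by force

end

theory Submission
  imports Defs "HOL-Number_Theory.Cong"
begin

text \<open>
  Label the vertices of the even cycle \<open>C\<^sub>r\<close> by \<open>z\<close> with values in \<open>{0..<S}\<close> such that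
  odd vertices carry larger labels than their neighbours and the edge differences are exactly
  the numbers below \<open>S\<close> not divisible by \<open>s\<close>. Put a copy of \<open>z\<close>, rotated by \<open>i\<close> columns,
  on row \<open>i\<close> of the cylinder (counting from 0), and add \<open>i * S\<close> to its even
  labels and \<open>(2 * m - 2 - i) * S\<close> to its odd ones. By the rotation a rung joins
  consecutive positions of the cycle, so rows and rungs alike show the differences of \<open>z\<close>,
  each time shifted by another one of the multiples \<open>0, S, ..., (2 * m - 2) * S\<close>.
  For \<open>r = 4 * k\<close> the labelling \<open>z\<close> is a zigzag whose differences skip the multiples of \<open>s\<close>.
  Translates modulo \<open>s * t\<close> give the blocks.
\<close>

section \<open>The complete multipartite graph on the residues modulo \<open>s * t\<close>, with the
  residue classes modulo \<open>s\<close> as parts\<close>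

definition residue_vertex :: "nat \<Rightarrow> nat \<Rightarrow> int \<Rightarrow> nat \<times> nat" where
  "residue_vertex s t z = (nat (z mod int s), nat ((z mod int (s * t)) div int s))"

text \<open>Translation by 1 on residues, with the identity outside the vertex set because
  \<open>permutes\<close> demands it.\<close>

definition rotate_vertex :: "nat \<Rightarrow> nat \<Rightarrow> nat \<times> nat \<Rightarrow> nat \<times> nat" where
  "rotate_vertex s t v = (if v \<in> {..<s} \<times> {..<t}
     then residue_vertex s t (int (fst v) + int s * int (snd v) + 1) else v)"

context
  fixes s t :: nat
  assumes pos: "s > 0" "t > 0"
begin

lemma residue_vertex_of_pair:
  assumes "a < s" "b < t"
  shows "residue_vertex s t (int a + int s * int b) = (a, b)"
proof -
  have "Suc b * s \<le> t * s" using assms by (intro mult_right_mono) auto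
  then have "a + s * b < s * t" using assms by (simp add: algebra_simps)
  then have "(int a + int s * int b) mod int (s * t) = int a + int s * int b"
    by (intro mod_pos_pos_trivial) (auto simp flip: of_nat_mult of_nat_add simp del: of_nat_mult of_nat_add)
  then show ?thesis using assms by (simp add: residue_vertex_def del: of_nat_mult)
qed

lemma residue_vertex_in: "residue_vertex s t z \<in> {..<s} \<times> {..<t}"
proof -
  have "int s * (z mod int (s * t) div int s) \<le> z mod int (s * t)"
    using pos mult_div_mod_eq[of "int s" "z mod int (s * t)"] pos_mod_sign[of "int s" "z mod int (s * t)"]
    by linarith
  also have "\<dots> < int s * int t" using pos pos_mod_bound[of "int (s * t)" z] by simp
  finally have "z mod int (s * t) div int s < int t" using pos by simp
  moreover have "0 \<le> z mod int (s * t) div int s"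
    using pos by (simp add: pos_imp_zdiv_nonneg_iff)
  ultimately show ?thesis using pos by (simp add: residue_vertex_def nat_less_iff)
qed

lemma range_residue_vertex: "range (residue_vertex s t) = {..<s} \<times> {..<t}"
proof
  show "range (residue_vertex s t) \<subseteq> {..<s} \<times> {..<t}" using residue_vertex_in by blast
  show "{..<s} \<times> {..<t} \<subseteq> range (residue_vertex s t)"
    by clarify (metis lessThan_iff rangeI residue_vertex_of_pair)
qed

lemma residue_vertex_recompose:
  "int (fst (residue_vertex s t z)) + int s * int (snd (residue_vertex s t z)) = z mod int (s * t)"
proof -
  have "z mod int (s * t) mod int s = z mod int s" by (simp add: mod_mult2_eq mod_mod_cancel)
  moreover have "0 \<le> z mod int (s * t) div int s" using pos by (simp add: pos_imp_zdiv_nonneg_iff)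
  ultimately show ?thesis
    using pos mod_mult_div_eq[of "z mod int (s * t)" "int s"] by (simp add: residue_vertex_def)
qed

lemma residue_vertex_eq_iff:
  "residue_vertex s t z = residue_vertex s t w \<longleftrightarrow> [z = w] (mod int (s * t))"
proof
  show "residue_vertex s t z = residue_vertex s t w \<Longrightarrow> [z = w] (mod int (s * t))"
    using residue_vertex_recompose[of z] residue_vertex_recompose[of w] by (simp add: cong_def)
  assume *: "[z = w] (mod int (s * t))"
  then have "[z = w] (mod int s)" by (rule cong_dvd_modulus) simp
  with * show "residue_vertex s t z = residue_vertex s t w"
    by (simp add: residue_vertex_def cong_def)
qed

lemma fst_residue_vertex_eq_iff:
  "fst (residue_vertex s t z) = fst (residue_vertex s t w) \<longleftrightarrow> int s dvd z - w"
  using pos by (simp add: residue_vertex_def eq_nat_nat_iff mod_eq_dvd_iff)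

lemma rotate_residue_vertex: "rotate_vertex s t (residue_vertex s t z) = residue_vertex s t (z + 1)"
proof -
  have "rotate_vertex s t (residue_vertex s t z) = residue_vertex s t (z mod int (s * t) + 1)"
    using residue_vertex_in[of z] by (simp only: rotate_vertex_def residue_vertex_recompose if_True)
  then show ?thesis by (simp add: residue_vertex_eq_iff cong_def mod_simps)
qed

lemma rotate_vertex_permutes: "rotate_vertex s t permutes {..<s} \<times> {..<t}"
proof (rule bij_imp_permutes)
  have "inj_on (rotate_vertex s t) (range (residue_vertex s t))"
    by (intro inj_onI, elim rangeE)
      (simp only: rotate_residue_vertex residue_vertex_eq_iff cong_add_rcancel)
  moreover have "rotate_vertex s t ` range (residue_vertex s t) = range (residue_vertex s t)"
  proof -
    have "rotate_vertex s t (residue_vertex s t (z - 1)) = residue_vertex s t z" for z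
      by (simp add: rotate_residue_vertex)
    then have "range (residue_vertex s t) \<subseteq> rotate_vertex s t ` range (residue_vertex s t)"
      by (metis image_eqI image_subsetI rangeI)
    moreover have "rotate_vertex s t ` range (residue_vertex s t) \<subseteq> range (residue_vertex s t)"
      by (simp add: image_subset_iff rotate_residue_vertex)
    ultimately show ?thesis by simp
  qed
  ultimately show "bij_betw (rotate_vertex s t) ({..<s} \<times> {..<t}) ({..<s} \<times> {..<t})"
    by (simp add: bij_betw_def range_residue_vertex)
qed (auto simp: rotate_vertex_def)

lemma rotate_vertex_cyclic: "cyclic_on (rotate_vertex s t) ({..<s} \<times> {..<t})"
proof -
  have pow: "(rotate_vertex s t ^^ i) (residue_vertex s t 0) = residue_vertex s t (int i)" for i
    by (induction i) (simp_all add: rotate_residue_vertex add.commute)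
  have "residue_vertex s t z \<in> orbit (rotate_vertex s t) (residue_vertex s t 0)" for z
  proof -
    \<comment> \<open>The summand \<open>s * t\<close> makes the exponent positive:
      \<open>orbit\<close> collects only positive powers, so the starting vertex itself is reached
      after a full turn.\<close>
    define i where "i = nat (z mod int (s * t)) + s * t"
    have "int i = z mod int (s * t) + int (s * t)" and "0 < i" using pos by (simp_all add: i_def)
    then have "residue_vertex s t z = (rotate_vertex s t ^^ i) (residue_vertex s t 0)"
      by (simp add: pow residue_vertex_eq_iff cong_def)
    then show ?thesis using \<open>0 < i\<close> by (auto simp: orbit_altdef)
  qed
  then have "range (residue_vertex s t) = orbit (rotate_vertex s t) (residue_vertex s t 0)"
    by (auto simp: orbit_altdef pow)
  then show ?thesis unfolding cyclic_on_def range_residue_vertex[symmetric] by blast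
qed

end


section \<open>Injective images of graphs, and edges in terms of differences\<close>

text \<open>\<open>isomorphic\<close> also asks that non-edges stay non-edges. Since
  \<open>F\<close> is injective on the vertices, taking images is injective on sets of vertices, so
  no pair outside \<open>edges G\<close> can land on the image of an edge.\<close>

lemma isomorphic_map_ugraph:
  assumes "simple_graph G" and "inj_on F (verts G)"
  shows "isomorphic G (map_ugraph F G)"
  unfolding isomorphic_def
proof (intro exI conjI ballI)
  show "bij_betw F (verts G) (verts (map_ugraph F G))"
    using assms(2) by (simp add: map_ugraph_def bij_betw_def)
  fix u v
  assume uv: "u \<in> verts G" "v \<in> verts G"
  have "edges G \<subseteq> Pow (verts G)" using assms(1) by (auto simp: simple_graph_def)
  then have "inj_on ((`) F) (insert {u, v} (edges G))"
    using uv by (intro inj_on_subset[OF inj_on_image_Pow[OF assms(2)]]) auto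
  then have "F ` {u, v} \<in> (`) F ` edges G \<longleftrightarrow> {u, v} \<in> edges G"
    by (intro inj_on_image_mem_iff[where B = "insert {u, v} (edges G)"]) auto
  then show "{u, v} \<in> edges G \<longleftrightarrow> {F u, F v} \<in> edges (map_ugraph F G)"
    by (simp add: map_ugraph_def)
qed

lemma simple_graph_map_ugraph:
  assumes "simple_graph G" and "inj_on F (verts G)"
  shows "simple_graph (map_ugraph F G)"
proof -
  have "F ` e \<in> {{u, v} | u v. u \<in> F ` verts G \<and> v \<in> F ` verts G \<and> u \<noteq> v}"
    if e: "e \<in> edges G" for e
  proof -
    obtain u v where uv: "e = {u, v}" "u \<in> verts G" "v \<in> verts G" "u \<noteq> v"
      using assms(1) e unfolding simple_graph_def by blast
    then have "F u \<noteq> F v" using assms(2) by (auto dest: inj_onD)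
    with uv show ?thesis by blast
  qed
  then show ?thesis by (auto simp: simple_graph_def map_ugraph_def)
qed

text \<open>Whether a pair is an edge depends only on its difference. Decomposing the graph thus
  becomes a matter of realising each admissible difference once up to sign.\<close>

lemma residue_edge_iff:
  assumes "s > 0" "t > 0"
  shows "{residue_vertex s t z, residue_vertex s t w} \<in> edges (complete_multipartite s t)
    \<longleftrightarrow> \<not> int s dvd w - z"
proof -
  have *: "fst (residue_vertex s t w) \<noteq> fst (residue_vertex s t z) \<longleftrightarrow> \<not> int s dvd w - z"
    using assms by (simp add: fst_residue_vertex_eq_iff)
  have "{residue_vertex s t z, residue_vertex s t w} \<in> edges (complete_multipartite s t)
    \<longleftrightarrow> fst (residue_vertex s t w) \<noteq> fst (residue_vertex s t z)"
  proof
    assume "fst (residue_vertex s t w) \<noteq> fst (residue_vertex s t z)"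
    then show "{residue_vertex s t z, residue_vertex s t w} \<in> edges (complete_multipartite s t)"
      using residue_vertex_in[OF assms, of z] residue_vertex_in[OF assms, of w]
      unfolding complete_multipartite_def ugraph.simps mem_Collect_eq
      by (intro exI[of _ "residue_vertex s t z"] exI[of _ "residue_vertex s t w"]) auto
  qed (auto simp: complete_multipartite_def doubleton_eq_iff)
  with * show ?thesis by simp
qed

section \<open>From a labelling with prescribed differences to a cyclic decomposition\<close>

text \<open>Translating the upper vertices of a block by multiples of \<open>L\<close> spreads the
  differences below \<open>L\<close> over all differences below \<open>s * t div 2\<close>.\<close>

lemma cyclic_decomposition_of_labelling:
  fixes G :: "'v ugraph" and f :: "'v \<Rightarrow> int" and lower upper :: "'i \<Rightarrow> 'v"
    and s t n :: nat and L :: int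
  assumes simple: "simple_graph G"
    and edges: "edges G = (\<lambda>e. {lower e, upper e}) ` I"
    and lower: "\<And>e. e \<in> I \<Longrightarrow> lower e \<in> verts G - Q"
    and upper: "\<And>e. e \<in> I \<Longrightarrow> upper e \<in> verts G \<inter> Q"
    and inj: "inj_on f (verts G)"
    and range: "f ` verts G \<subseteq> {0..<L}"
    and differences: "bij_betw (\<lambda>e. f (upper e) - f (lower e)) I {d \<in> {1..<L}. \<not> int s dvd d}"
    and "int s dvd L" and "L > 0" and "n > 0" and "s > 0"
    and order: "int (s * t) = 2 * L * int n"
  shows "\<exists>\<B>. is_cyclic_decomposition G (complete_multipartite s t) \<B>"
proof -
  let ?N = "int (s * t)" and ?K = "complete_multipartite s t" and ?\<psi> = "residue_vertex s t"
  have "s * t > 0" using order \<open>L > 0\<close> \<open>n > 0\<close>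
    by (metis mult_pos_pos of_nat_0_less_iff zero_less_numeral)
  then have st: "s > 0" "t > 0" by auto
  have N: "?N = int n * L + int n * L" using order by simp
  define h where "h i v = f v + (if v \<in> Q then int i * L else 0)" for i v
  define block where "block i \<tau> = map_ugraph (\<lambda>v. ?\<psi> (h i v + \<tau>)) G" for i and \<tau> :: int
  \<comment> \<open>There are \<open>n\<close> base blocks, each with all its translates. Letting
    \<tau> run over all integers merely repeats blocks with period \<open>s * t\<close> and makes
    invariance under translation immediate.\<close>
  define \<B> where "\<B> = {block i \<tau> | i \<tau>. i < n}"

  have h_range: "0 \<le> h i v" "h i v < ?N" if "i < n" "v \<in> verts G" for i v
  proof -
    have f: "0 \<le> f v" "f v < L" using range that(2) by auto
    have "(int i + 1) * L \<le> int n * L" using that(1) \<open>L > 0\<close> by (intro mult_right_mono) auto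
    moreover have "0 \<le> int i * L" using \<open>L > 0\<close> by simp
    ultimately have "0 \<le> f v + int i * L" "f v < int n * L" "f v + int i * L < int n * L"
      using f by (simp_all only: distrib_right)
    then have "0 \<le> h i v" "h i v < int n * L" using f by (simp_all add: h_def)
    then show "0 \<le> h i v" "h i v < ?N" unfolding N by linarith+
  qed
  have h_inj: "inj_on (h i) (verts G)" if "i < n" for i
  proof (rule inj_onI)
    fix u v
    assume uv: "u \<in> verts G" "v \<in> verts G" and eq: "h i u = h i v"
    have f: "0 \<le> f u" "f u < L" "0 \<le> f v" "f v < L" using range uv by auto
    define w where "w = int i * L"
    \<comment> \<open>A lower and an upper vertex could share a label only for \<open>i = 0\<close>,
      where \<open>h i\<close> is \<open>f\<close>; otherwise upper labels are at least
      \<open>L\<close> and lower ones are below it.\<close>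
    have "w = 0 \<or> L \<le> w" using \<open>L > 0\<close> unfolding w_def by (cases i) (auto simp: algebra_simps)
    then have "f u = f v" using eq f by (auto simp: h_def simp flip: w_def split: if_splits)
    with inj uv show "u = v" by (auto dest: inj_onD)
  qed
  have block_inj: "inj_on (\<lambda>v. ?\<psi> (h i v + \<tau>)) (verts G)" if "i < n" for i \<tau>
  proof (rule inj_onI)
    fix u v
    assume uv: "u \<in> verts G" "v \<in> verts G" and "?\<psi> (h i u + \<tau>) = ?\<psi> (h i v + \<tau>)"
    then have "[h i u = h i v] (mod ?N)" by (simp only: residue_vertex_eq_iff[OF st] cong_add_rcancel)
    then have "h i u = h i v" using h_range[OF that] uv by (simp add: cong_def del: of_nat_mult)
    with h_inj[OF that] uv show "u = v" by (auto dest: inj_onD)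
  qed
  have block_edges: "edges (block i \<tau>) = (\<lambda>e. {?\<psi> (h i (lower e) + \<tau>), ?\<psi> (h i (upper e) + \<tau>)}) ` I" for i \<tau>
    by (simp add: block_def map_ugraph_def edges image_image)

  define \<Delta> where "\<Delta> e = f (upper e) - f (lower e)" for e
  have h_diff: "h i (upper e) - h i (lower e) = \<Delta> e + int i * L" if "e \<in> I" for i e
    using lower[OF that] upper[OF that] by (simp add: h_def \<Delta>_def)
  have \<Delta>: "0 < \<Delta> e" "\<Delta> e < L" "\<not> int s dvd \<Delta> e" if "e \<in> I" for e
    using bij_betwE[OF differences] that unfolding \<Delta>_def by fastforce+
  have \<Delta>_shift: "0 < \<Delta> e + int i * L" "\<Delta> e + int i * L < int n * L" "\<not> int s dvd \<Delta> e + int i * L"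
    if "e \<in> I" "i < n" for e i
  proof -
    have "(int i + 1) * L \<le> int n * L" using that(2) \<open>L > 0\<close> by (intro mult_right_mono) auto
    moreover have "0 \<le> int i * L" using \<open>L > 0\<close> by simp
    ultimately show "0 < \<Delta> e + int i * L" "\<Delta> e + int i * L < int n * L"
      using \<Delta>[OF that(1)] by (simp_all only: distrib_right)
    show "\<not> int s dvd \<Delta> e + int i * L"
      using \<Delta>(3)[OF that(1)] \<open>int s dvd L\<close> by (simp add: dvd_add_left_iff)
  qed

  have sub: "subgraph B ?K \<and> isomorphic G B" if "B \<in> \<B>" for B
  proof -
    obtain i \<tau> where B: "B = block i \<tau>" and i: "i < n" using \<open>B \<in> \<B>\<close> by (auto simp: \<B>_def)
    have "simple_graph B" "isomorphic G B"
      unfolding B block_def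
      using simple_graph_map_ugraph isomorphic_map_ugraph simple block_inj[OF i] by blast+
    moreover have "verts B \<subseteq> verts ?K"
      using residue_vertex_in[OF st]
      by (simp add: B block_def map_ugraph_def complete_multipartite_def image_subset_iff mem_Times_iff)
    moreover have "edges B \<subseteq> edges ?K"
      unfolding B block_edges
    proof (rule image_subsetI)
      fix e assume e: "e \<in> I"
      then have "\<not> int s dvd (h i (upper e) + \<tau>) - (h i (lower e) + \<tau>)"
        using h_diff \<Delta>_shift(3) i by simp
      then show "{?\<psi> (h i (lower e) + \<tau>), ?\<psi> (h i (upper e) + \<tau>)} \<in> edges ?K"
        by (rule residue_edge_iff[OF st, THEN iffD2])
    qed
    ultimately show ?thesis by (simp add: subgraph_def simple_graph_complete_multipartite)
  qed

  have disj: "disjoint_family_on edges \<B>"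
    unfolding disjoint_family_on_def
  proof (intro ballI impI, rule ccontr)
    fix B B'
    assume "B \<in> \<B>" "B' \<in> \<B>" "B \<noteq> B'" and meet: "edges B \<inter> edges B' \<noteq> {}"
    then obtain i \<tau> i' \<tau>' where B: "B = block i \<tau>" "i < n" and B': "B' = block i' \<tau>'" "i' < n"
      by (auto simp: \<B>_def)
    from meet obtain e e' where e: "e \<in> I" "e' \<in> I"
      and eq: "{?\<psi> (h i (lower e) + \<tau>), ?\<psi> (h i (upper e) + \<tau>)}
             = {?\<psi> (h i' (lower e') + \<tau>'), ?\<psi> (h i' (upper e') + \<tau>')}"
      unfolding B B' block_edges by blast
    let ?d = "\<Delta> e + int i * L" and ?d' = "\<Delta> e' + int i' * L"
    have bounds: "0 < ?d" "?d < int n * L" "0 < ?d'" "?d' < int n * L"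
      using \<Delta>_shift e B B' by auto
    from eq consider
      (same) "?\<psi> (h i (lower e) + \<tau>) = ?\<psi> (h i' (lower e') + \<tau>')"
        "?\<psi> (h i (upper e) + \<tau>) = ?\<psi> (h i' (upper e') + \<tau>')"
      | (swapped) "?\<psi> (h i (lower e) + \<tau>) = ?\<psi> (h i' (upper e') + \<tau>')"
        "?\<psi> (h i (upper e) + \<tau>) = ?\<psi> (h i' (lower e') + \<tau>')"
      by (auto simp: doubleton_eq_iff)
    then show False
    proof cases
      case same
      then have "[(h i (upper e) + \<tau>) - (h i (lower e) + \<tau>) = (h i' (upper e') + \<tau>') - (h i' (lower e') + \<tau>')] (mod ?N)"
        unfolding residue_vertex_eq_iff[OF st] by (intro cong_diff)
      then have "[?d = ?d'] (mod ?N)" using h_diff e by simp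
      moreover have "?d < ?N" "?d' < ?N" using bounds N by linarith+
      ultimately have d: "?d = ?d'" using bounds by (intro cong_less_imp_eq_int[of ?d ?N ?d']) simp_all
      \<comment> \<open>As \<open>\<Delta> e\<close> lies strictly between 0 and \<open>L\<close>,
        division by \<open>L\<close> recovers the base block from the difference, and the remainder
        recovers the edge.\<close>
      have "int i = ?d div L" "int i' = ?d' div L"
        using \<Delta>[OF e(1)] \<Delta>[OF e(2)] \<open>L > 0\<close> by (simp_all add: div_pos_pos_trivial)
      then have "i = i'" using d by simp
      then have "\<Delta> e = \<Delta> e'" using d by simp
      then have "e = e'" using differences e unfolding \<Delta>_def bij_betw_def by (auto dest: inj_onD)
      \<comment> \<open>With block and edge known, the position of one endpoint fixes the
        translation modulo \<open>s * t\<close>.\<close>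
      then have "[\<tau> = \<tau>'] (mod ?N)"
        using same(1) \<open>i = i'\<close> by (simp only: residue_vertex_eq_iff[OF st] cong_add_lcancel)
      then have "?\<psi> (h i v + \<tau>) = ?\<psi> (h i v + \<tau>')" for v
        by (simp only: residue_vertex_eq_iff[OF st] cong_add_lcancel)
      then have "B = B'" using \<open>i = i'\<close> by (simp add: B B' block_def)
      with \<open>B \<noteq> B'\<close> show False by simp
    next
      case swapped
      then have "[(h i (upper e) + \<tau>) - (h i (lower e) + \<tau>) = (h i' (lower e') + \<tau>') - (h i' (upper e') + \<tau>')] (mod ?N)"
        unfolding residue_vertex_eq_iff[OF st] by (intro cong_diff)
      then have "?N dvd ?d + ?d'"
        using h_diff[OF e(1), of i] h_diff[OF e(2), of i'] unfolding cong_iff_dvd_diff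
        by (simp add: algebra_simps)
      \<comment> \<open>All differences stay below \<open>int n * L\<close>, half of
        \<open>s * t\<close>, so none is the negative of another and no edge is covered in
        reverse.\<close>
      moreover have "0 < ?d + ?d'" "?d + ?d' < ?N" using bounds N by linarith+
      ultimately show False using zdvd_not_zless by blast
    qed
  qed

  \<comment> \<open>Here \<open>d div L\<close> chooses the base block, \<open>d mod L\<close> the
    edge in it, and the translation moves the lower end of that edge to \<open>z\<close>.\<close>
  have covered: "\<exists>B\<in>\<B>. {?\<psi> z, ?\<psi> (z + d)} \<in> edges B"
    if d: "0 < d" "d < int n * L" "\<not> int s dvd d" for z d
  proof -
    define i where "i = nat (d div L)"
    have i: "int i = d div L" using d \<open>L > 0\<close> by (simp add: i_def pos_imp_zdiv_nonneg_iff)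
    have "L * (d div L) \<le> d"
      using mult_div_mod_eq[of L d] pos_mod_sign[of L d] \<open>L > 0\<close> by linarith
    also have "\<dots> < L * int n" using d(2) by (simp add: mult.commute)
    finally have "i < n" using i \<open>L > 0\<close> by simp
    have dm: "d = d mod L + int i * L" unfolding i by simp
    then have ndvd: "\<not> int s dvd d mod L" using d(3) \<open>int s dvd L\<close> by (metis dvd_add dvd_mult)
    then have "d mod L \<noteq> 0" by auto
    moreover have "0 \<le> d mod L" "d mod L < L" using \<open>L > 0\<close> by auto
    ultimately have "d mod L \<in> {d \<in> {1..<L}. \<not> int s dvd d}" using ndvd by auto
    then have "d mod L \<in> \<Delta> ` I"
      using bij_betw_imp_surj_on[OF differences] unfolding \<Delta>_def by simp
    then obtain e where e: "e \<in> I" "\<Delta> e = d mod L" by auto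
    have "h i (upper e) + (z - h i (lower e)) = z + d" "h i (lower e) + (z - h i (lower e)) = z"
      using h_diff[OF e(1), of i] e(2) dm by simp_all
    then have "{?\<psi> z, ?\<psi> (z + d)} \<in> edges (block i (z - h i (lower e)))"
      unfolding block_edges by (intro image_eqI[OF _ e(1)]) (simp only:)
    then show ?thesis using \<open>i < n\<close> by (auto simp: \<B>_def)
  qed
  have "edges ?K \<subseteq> (\<Union>B\<in>\<B>. edges B)"
  proof
    fix E assume E: "E \<in> edges ?K"
    then obtain u v where uv: "E = {u, v}" "u \<in> {..<s} \<times> {..<t}" "v \<in> {..<s} \<times> {..<t}"
      unfolding complete_multipartite_def ugraph.simps by blast
    then obtain z w where zw: "u = ?\<psi> z" "v = ?\<psi> w" using range_residue_vertex[OF st] by blast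
    define d where "d = (w - z) mod ?N"
    have "?\<psi> w = ?\<psi> (z + d)" unfolding residue_vertex_eq_iff[OF st] d_def cong_def by (simp add: mod_simps)
    then have E': "E = {?\<psi> z, ?\<psi> (z + d)}" using uv zw by simp
    then have ndvd: "\<not> int s dvd d" using E residue_edge_iff[OF st, of z "z + d"] by simp
    have d: "0 \<le> d" "d < ?N" using \<open>s * t > 0\<close> by (simp_all add: d_def del: of_nat_mult)
    \<comment> \<open>The midpoint \<open>int n * L\<close> of the residues is a multiple of
      \<open>s\<close>, hence never the difference of an edge. Every edge therefore has a difference
      below the midpoint in one of its two directions.\<close>
    have "d \<noteq> 0" "d \<noteq> int n * L" using ndvd \<open>int s dvd L\<close> by auto
    then consider "0 < d \<and> d < int n * L" | "0 < ?N - d \<and> ?N - d < int n * L"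
      using d N by linarith
    then show "E \<in> (\<Union>B\<in>\<B>. edges B)"
    proof cases
      case 1
      with covered[of d z] ndvd show ?thesis unfolding E' by blast
    next
      case 2
      have "?\<psi> (z + d + (?N - d)) = ?\<psi> z" unfolding residue_vertex_eq_iff[OF st] cong_def by simp
      moreover have "\<not> int s dvd ?N - d" using ndvd by (simp add: dvd_diff_right_iff)
      ultimately have "\<exists>B\<in>\<B>. {?\<psi> (z + d), ?\<psi> z} \<in> edges B"
        using 2 covered[of "?N - d" "z + d"] by presburger
      then show ?thesis unfolding E' by (auto simp: insert_commute)
    qed
  qed
  with sub have cover: "(\<Union>B\<in>\<B>. edges B) = edges ?K" by (auto simp: subgraph_def)

  have verts: "verts ?K = {..<s} \<times> {..<t}" by (simp add: complete_multipartite_def)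
  have rot: "map_ugraph (rotate_vertex s t) (block i \<tau>) = block i (\<tau> + 1)" for i \<tau>
    by (simp add: block_def map_ugraph_def image_image rotate_residue_vertex[OF st] add.assoc)
  have "map_ugraph (rotate_vertex s t) ` \<B> = \<B>"
  proof
    show "map_ugraph (rotate_vertex s t) ` \<B> \<subseteq> \<B>"
      unfolding \<B>_def by (auto simp: rot) blast
    show "\<B> \<subseteq> map_ugraph (rotate_vertex s t) ` \<B>"
    proof
      fix B assume "B \<in> \<B>"
      then obtain i \<tau> where "B = block i \<tau>" "i < n" by (auto simp: \<B>_def)
      then have "B = map_ugraph (rotate_vertex s t) (block i (\<tau> - 1))" "block i (\<tau> - 1) \<in> \<B>"
        using \<open>i < n\<close> by (auto simp: rot \<B>_def)
      then show "B \<in> map_ugraph (rotate_vertex s t) ` \<B>" by blast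
    qed
  qed
  then show ?thesis
    using sub disj cover rotate_vertex_permutes[OF st] rotate_vertex_cyclic[OF st]
    unfolding is_cyclic_decomposition_def is_decomposition_def verts by blast
qed

section \<open>From a labelled cycle to a labelled cylinder\<close>

lemma exists_shift_mod:
  fixes r a c :: nat
  assumes "c < r"
  obtains j where "j \<in> {1..r}" "(a + j) mod r = c"
proof -
  \<comment> \<open>The multiple \<open>r * Suc a\<close> keeps the natural subtraction from
    truncating; subtracting 1 inside and adding 1 outside puts the result into \<open>{1..r}\<close>
    instead of \<open>{0..<r}\<close>.\<close>
  define j where "j = (c + r * Suc a - a - 1) mod r + 1"
  have "a < r * Suc a" using assms by (cases r) auto
  then have "a + (c + r * Suc a - a - 1) + 1 = c + r * Suc a" by linarith
  then have "(a + j) mod r = c" using assms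
    unfolding j_def by (metis mod_add_right_eq mod_less mod_mult_self2 add.assoc add.commute)
  moreover have "j \<in> {1..r}" using assms by (simp add: j_def Suc_leI)
  ultimately show thesis by (rule that[rotated])
qed

lemma shift_mod_inj:
  fixes r a j j' :: nat
  assumes "(a + j) mod r = (a + j') mod r" "j \<in> {1..r}" "j' \<in> {1..r}"
  shows "j = j'"
proof -
  have "[j = j'] (mod r)" using assms(1) by (simp add: cong_def[symmetric] cong_add_lcancel_nat)
  then have "[int j = int j'] (mod int r)" by (simp add: cong_int_iff)
  then have "int r dvd int j - int j'" by (simp add: cong_iff_dvd_diff)
  moreover have "\<bar>int j - int j'\<bar> < int r" using assms by auto
  ultimately show ?thesis by (metis dvd_imp_le_int eq_iff_diff_eq_0 abs_of_nat linorder_not_less of_nat_eq_iff)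
qed

text \<open>The differences of the cylinder arise from those of the cycle by adding one of
  \<open>2 * m - 1\<close> multiples of \<open>S\<close>, and division by \<open>S\<close> separates
  the two parts again. The function \<open>D\<close> allows the cycle differences to be supplied in
  closed form.\<close>

lemma cyclic_decomposition_cylinder:
  fixes z D :: "nat \<Rightarrow> int" and S :: int and r m n s t :: nat
  assumes r: "even r" "r \<ge> 2" and m: "m \<ge> 1" and n: "n > 0" and s: "s > 0"
    and inj: "inj_on z {..<r}"
    and range: "\<And>c. c < r \<Longrightarrow> z c \<in> {0..<S}"
    and D: "\<And>c. c < r \<Longrightarrow> D c = (if even c then z (Suc c mod r) - z c else z c - z (Suc c mod r))"
    and bij: "bij_betw D {..<r} {d \<in> {1..<S}. \<not> int s dvd d}"
    and dvd: "int s dvd S"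
    and order: "int (s * t) = 2 * ((2 * int m - 1) * S) * int n"
  shows "\<exists>\<B>. is_cyclic_decomposition (cylinder r m) (complete_multipartite s t) \<B>"
proof -
  have "S > 0" using range[of 0] r by simp
  \<comment> \<open>The position on the cycle whose label the vertex inherits; rows start at 1, so
    the first row is rotated by 0.\<close>
  define col where "col v = (fst v - 1 + snd v) mod r" for v :: "nat \<times> nat"
  \<comment> \<open>From row 1 to row \<open>m\<close>, even levels rise from 0 to
    \<open>m - 1\<close> and odd levels fall from \<open>2 * m - 2\<close> to
    \<open>m - 1\<close>.\<close>
  define level where "level v = (if even (col v) then int (fst v) - 1 else 2 * int m - 1 - int (fst v))" for v
  define f where "f v = z (col v) + level v * S" for v
  \<comment> \<open>Edges come in \<open>2 * m - 1\<close> layers of \<open>r\<close>: the even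
    layer \<open>2 * (i - 1)\<close> is row \<open>i\<close>, and the odd layer after it holds the
    rungs from row \<open>i\<close> to row \<open>i + 1\<close>.\<close>
  define base where "base e = (fst e div 2 + 1, snd e)" for e :: "nat \<times> nat"
  define succ where "succ e = (if even (fst e) then (fst e div 2 + 1, snd e mod r + 1) else (fst e div 2 + 2, snd e))"
    for e :: "nat \<times> nat"
  define lower where "lower e = (if even (col (base e)) then base e else succ e)" for e
  define upper where "upper e = (if even (col (base e)) then succ e else base e)" for e
  define I where "I = {..<2 * m - 1} \<times> {1..r}"
  have verts: "verts (cylinder r m) = {1..m} \<times> {1..r}" by (simp add: cylinder_def)

  have col_less: "col v < r" for v using r by (simp add: col_def)
  have col_base: "col (base e) = (fst e div 2 + snd e) mod r" for e by (simp add: col_def base_def)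
  \<comment> \<open>Along a row the column advances; along a rung the rotation does. Either way the
    cycle position advances by one.\<close>
  have col_succ: "col (succ e) = Suc (col (base e)) mod r" for e
    by (simp add: col_def base_def succ_def mod_simps) (metis mod_Suc_eq mod_add_right_eq)
  \<comment> \<open>Evenness of \<open>r\<close> preserves the alternation at the wrap-around, so
    each edge has one even and one odd end.\<close>
  have parity: "even (col (succ e)) \<longleftrightarrow> odd (col (base e))" for e
    using r by (simp add: col_succ dvd_mod_iff)

  have base_in: "base e \<in> verts (cylinder r m)" if "e \<in> I" for e
    using that by (auto simp: I_def verts base_def)
  have succ_in: "succ e \<in> verts (cylinder r m)" if "e \<in> I" for e
  proof -
    have "snd e mod r + 1 \<le> r" using r mod_less_divisor[of r "snd e"] by linarith
    moreover have "fst e div 2 + 2 \<le> m" if "odd (fst e)"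
      using that \<open>e \<in> I\<close> unfolding I_def by (auto elim!: oddE)
    moreover have "fst e div 2 + 1 \<le> m" "snd e \<in> {1..r}" using that by (auto simp: I_def)
    ultimately show ?thesis by (auto simp: verts succ_def)
  qed

  have "edges (cylinder r m) = (\<lambda>e. {base e, succ e}) ` I"
  proof
    have row: "{(i, j), (i, j mod r + 1)} \<in> (\<lambda>e. {base e, succ e}) ` I"
      if "1 \<le> i" "i \<le> m" "1 \<le> j" "j \<le> r" for i j
      using that by (intro image_eqI[of _ _ "(2 * (i - 1), j)"]) (auto simp: base_def succ_def I_def)
    have rung: "{(i, j), (i + 1, j)} \<in> (\<lambda>e. {base e, succ e}) ` I"
      if "1 \<le> i" "i < m" "1 \<le> j" "j \<le> r" for i j
    proof (rule image_eqI[of _ _ "(2 * (i - 1) + 1, j)"])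
      have "(2 * (i - 1) + 1) div 2 = i - 1" by presburger
      then show "{(i, j), (i + 1, j)} = {base (2 * (i - 1) + 1, j), succ (2 * (i - 1) + 1, j)}"
        using that by (simp add: base_def succ_def)
    qed (use that in \<open>auto simp: I_def\<close>)
    show "edges (cylinder r m) \<subseteq> (\<lambda>e. {base e, succ e}) ` I"
      unfolding cylinder_def ugraph.simps using row rung by (intro Un_least subsetI; elim CollectE exE conjE; simp only:)
    show "(\<lambda>e. {base e, succ e}) ` I \<subseteq> edges (cylinder r m)"
    proof (rule image_subsetI)
      fix e assume "e \<in> I"
      then obtain p j where e: "e = (p, j)" "p < 2 * m - 1" "1 \<le> j" "j \<le> r" by (auto simp: I_def)
      show "{base e, succ e} \<in> edges (cylinder r m)"
      proof (cases "even p")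
        case True
        have "p div 2 + 1 \<le> m" using e by linarith
        then have "\<exists>i j'. {base e, succ e} = {(i, j'), (i, j' mod r + 1)} \<and> 1 \<le> i \<and> i \<le> m \<and> 1 \<le> j' \<and> j' \<le> r"
          using e True by (intro exI[of _ "p div 2 + 1"] exI[of _ j]) (simp add: base_def succ_def)
        then show ?thesis unfolding cylinder_def by simp
      next
        case False
        have "p div 2 + 1 < m" using e False by presburger
        then have "\<exists>i j'. {base e, succ e} = {(i, j'), (i + 1, j')} \<and> 1 \<le> i \<and> i < m \<and> 1 \<le> j' \<and> j' \<le> r"
          using e False by (intro exI[of _ "p div 2 + 1"] exI[of _ j]) (simp add: base_def succ_def)
        then show ?thesis unfolding cylinder_def by simp
      qed
    qed
  qed
  moreover have "{lower e, upper e} = {base e, succ e}" for e by (auto simp: lower_def upper_def)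
  ultimately have edges: "edges (cylinder r m) = (\<lambda>e. {lower e, upper e}) ` I" by simp

  have lower: "lower e \<in> verts (cylinder r m) - {v. odd (col v)}" if "e \<in> I" for e
    using base_in[OF that] succ_in[OF that] parity by (simp add: lower_def)
  have upper: "upper e \<in> verts (cylinder r m) \<inter> {v. odd (col v)}" if "e \<in> I" for e
    using base_in[OF that] succ_in[OF that] parity by (simp add: upper_def)

  have split_S: "(x + q * S) mod S = x" "(x + q * S) div S = q" if "x \<in> {0..<S}" for x q
    using that \<open>S > 0\<close> by simp_all
  have f_inj: "inj_on f (verts (cylinder r m))"
  proof (rule inj_onI)
    fix u v assume uv: "u \<in> verts (cylinder r m)" "v \<in> verts (cylinder r m)" and eq: "f u = f v"
    have "z (col u) = z (col v)" "level u = level v"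
      using split_S[OF range[OF col_less], of u "level u"] split_S[OF range[OF col_less], of v "level v"] eq
      unfolding f_def by argo+
    then have c: "col u = col v" using inj_onD[OF inj, of "col u" "col v"] col_less by simp
    \<comment> \<open>For a fixed parity of the cycle position, the level is an injective function
      of the row.\<close>
    have fst: "fst u = fst v"
      using \<open>level u = level v\<close> unfolding level_def c by (cases "even (col v)") simp_all
    have "(fst v - 1 + snd u) mod r = (fst v - 1 + snd v) mod r" using c unfolding col_def fst .
    moreover have "snd u \<in> {1..r}" "snd v \<in> {1..r}" using uv by (auto simp: verts)
    ultimately have "snd u = snd v" by (rule shift_mod_inj)
    with fst show "u = v" by (rule prod_eqI)
  qed
  have mult_range: "x + q * S \<in> {0..<(2 * int m - 1) * S}"
    if x: "x \<in> {0..<S}" and q: "0 \<le> q" "q \<le> 2 * int m - 2" for x q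
  proof -
    have "(q + 1) * S \<le> (2 * int m - 1) * S" using q \<open>S > 0\<close> by (intro mult_right_mono) auto
    moreover have "0 \<le> q * S" using q \<open>S > 0\<close> by simp
    ultimately show ?thesis using x by (simp only: distrib_right atLeastLessThan_iff) linarith
  qed
  have f_range: "f ` verts (cylinder r m) \<subseteq> {0..<(2 * int m - 1) * S}"
    unfolding f_def by (intro image_subsetI mult_range range col_less) (auto simp: level_def verts)

  define \<Delta> where "\<Delta> e = D (col (base e)) + (2 * int m - 2 - int (fst e)) * S" for e :: "nat \<times> nat"
  have diff: "f (upper e) - f (lower e) = \<Delta> e" for e
  proof -
    have "level (upper e) - level (lower e) = 2 * int m - 2 - int (fst e)"
    proof (cases "even (fst e)")
      case True
      then obtain q where "fst e = 2 * q" by (rule evenE)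
      then show ?thesis using parity[of e]
        by (simp add: level_def upper_def lower_def) (simp add: base_def succ_def)
    next
      case False
      then obtain q where "fst e = 2 * q + 1" by (rule oddE)
      then show ?thesis using parity[of e]
        by (simp add: level_def upper_def lower_def) (simp add: base_def succ_def)
    qed
    moreover have "z (col (upper e)) - z (col (lower e)) = D (col (base e))"
      using D[OF col_less, of "base e"] by (simp add: upper_def lower_def col_succ)
    moreover have "f (upper e) - f (lower e)
        = (z (col (upper e)) - z (col (lower e))) + (level (upper e) - level (lower e)) * S"
      by (simp add: f_def left_diff_distrib)
    ultimately show ?thesis unfolding \<Delta>_def by simp
  qed
  have D_in: "D c \<in> {d \<in> {1..<S}. \<not> int s dvd d}" if "c < r" for c
    using bij_betwE[OF bij] that by blast
  have D_range: "D (col v) \<in> {0..<S}" for v using D_in[OF col_less[of v]] by auto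
  have "bij_betw \<Delta> I {d \<in> {1..<(2 * int m - 1) * S}. \<not> int s dvd d}"
    unfolding bij_betw_def
  proof
    show "inj_on \<Delta> I"
    proof (rule inj_onI)
      fix e e' assume I: "e \<in> I" "e' \<in> I" and eq: "\<Delta> e = \<Delta> e'"
      have "D (col (base e)) = D (col (base e'))" "2 * int m - 2 - int (fst e) = 2 * int m - 2 - int (fst e')"
        using split_S[OF D_range, of "base e" "2 * int m - 2 - int (fst e)"]
          split_S[OF D_range, of "base e'" "2 * int m - 2 - int (fst e')"] eq
        unfolding \<Delta>_def by argo+
      then have c: "col (base e) = col (base e')" and fst: "fst e = fst e'"
        using inj_onD[OF bij_betw_imp_inj_on[OF bij], of "col (base e)" "col (base e')"] col_less by simp_all
      have "(fst e' div 2 + snd e) mod r = (fst e' div 2 + snd e') mod r" using c unfolding col_base fst .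
      moreover have "snd e \<in> {1..r}" "snd e' \<in> {1..r}" using I by (auto simp: I_def)
      ultimately have "snd e = snd e'" by (rule shift_mod_inj)
      with fst show "e = e'" by (rule prod_eqI)
    qed
    show "\<Delta> ` I = {d \<in> {1..<(2 * int m - 1) * S}. \<not> int s dvd d}"
    proof
      have "\<Delta> e \<in> {d \<in> {1..<(2 * int m - 1) * S}. \<not> int s dvd d}" if "e \<in> I" for e
      proof -
        have "\<Delta> e \<in> {0..<(2 * int m - 1) * S}"
          unfolding \<Delta>_def using that by (intro mult_range D_range) (auto simp: I_def)
        moreover have "\<not> int s dvd \<Delta> e"
          using D_in[OF col_less[of "base e"]] dvd by (simp add: \<Delta>_def dvd_add_left_iff)
        moreover from this have "\<Delta> e \<noteq> 0" by auto
        ultimately show ?thesis by auto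
      qed
      then show "\<Delta> ` I \<subseteq> {d \<in> {1..<(2 * int m - 1) * S}. \<not> int s dvd d}" by blast
      show "{d \<in> {1..<(2 * int m - 1) * S}. \<not> int s dvd d} \<subseteq> \<Delta> ` I"
      proof
        fix d assume d: "d \<in> {d \<in> {1..<(2 * int m - 1) * S}. \<not> int s dvd d}"
        then have "\<not> int s dvd d mod S" using dvd by (simp add: dvd_mod_iff)
        moreover from this have "d mod S \<noteq> 0" by auto
        moreover have "0 \<le> d mod S" "d mod S < S" using \<open>S > 0\<close> by simp_all
        ultimately have "d mod S \<in> D ` {..<r}" unfolding bij_betw_imp_surj_on[OF bij] by auto
        then obtain c where c: "c < r" "D c = d mod S" by auto
        have "S * (d div S) \<le> d"
          using mult_div_mod_eq[of S d] pos_mod_sign[of S d] \<open>S > 0\<close> by linarith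
        also have "d < S * (2 * int m - 1)" using d by (simp add: mult.commute)
        finally have "d div S < 2 * int m - 1" using \<open>S > 0\<close> by simp
        moreover have "0 \<le> d div S" using d \<open>S > 0\<close> by (simp add: pos_imp_zdiv_nonneg_iff)
        \<comment> \<open>Layer \<open>p\<close> contributes \<open>2 * m - 2 - p\<close> multiples
          of \<open>S\<close>; this solves for the layer from the quotient.\<close>
        moreover define p where "p = nat (2 * int m - 2 - d div S)"
        ultimately have p: "p < 2 * m - 1" "int p = 2 * int m - 2 - d div S" by auto
        \<comment> \<open>Each layer meets every cycle position once, so the required cycle edge
          \<open>c\<close> occurs in layer \<open>p\<close>.\<close>
        obtain j where j: "j \<in> {1..r}" "(p div 2 + j) mod r = c" using exists_shift_mod[OF c(1)] .
        have "\<Delta> (p, j) = d" using c j p by (simp add: \<Delta>_def col_base mod_div_mult_eq)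
        moreover have "(p, j) \<in> I" using p j by (simp add: I_def)
        ultimately show "d \<in> \<Delta> ` I" by blast
      qed
    qed
  qed
  then have differences: "bij_betw (\<lambda>e. f (upper e) - f (lower e)) I {d \<in> {1..<(2 * int m - 1) * S}. \<not> int s dvd d}"
    by (simp add: diff)
  show ?thesis
    by (rule cyclic_decomposition_of_labelling[OF _ edges lower upper f_inj f_range differences _ _ n s order])
      (use simple_graph_cylinder r dvd \<open>S > 0\<close> m in auto)
qed

section \<open>The zigzag labelling of the cycle of length \<open>4 * k\<close>\<close>

text \<open>
  The differences decrease along the path \<open>0, 1, ..., 4 * k - 1\<close>; \<open>h\<close> skips one value in the
  middle, \<open>g\<close> one value after each outer quarter, and the closing edge takes the
  additional value skipped in the middle. The parity of \<open>k\<close> decides which of the two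
  monotone halves of the zigzag has to jump at an outer gap.
\<close>

definition zigzag :: "nat \<Rightarrow> bool \<Rightarrow> bool \<Rightarrow> nat \<Rightarrow> int" where
  "zigzag k g h c =
    (if even c then int (c div 2) + of_bool (g \<and> (if even k then 3 * k else k) \<le> c)
     else int (4 * k + 2 * of_bool g + of_bool h) - int (c div 2)
       - of_bool (g \<and> (if even k then k else 3 * k) \<le> c)
       - (if 2 * k \<le> c then of_bool h + 1 else 0))"

text \<open>Edge \<open>c\<close> joins positions \<open>c\<close> and \<open>c + 1\<close>. At the
  gap near \<open>k\<close> the half of parity opposite to \<open>k\<close> jumps, first at position
  \<open>k + 1\<close>, so edge \<open>k\<close> feels it first. Near \<open>3 * k\<close> the other
  half jumps, at position \<open>3 * k\<close> itself, so edge \<open>3 * k - 1\<close> already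
  feels it; hence the test on \<open>c + 1\<close>.\<close>

definition zigzag_diff :: "nat \<Rightarrow> bool \<Rightarrow> bool \<Rightarrow> nat \<Rightarrow> int" where
  "zigzag_diff k g h c =
    (if c = 4 * k - 1 then int (2 * k) + of_bool g
     else int (4 * k + 2 * of_bool g + of_bool h) - int c - of_bool (g \<and> k \<le> c)
       - (if 2 * k \<le> c then of_bool h + 1 else 0) - of_bool (g \<and> 3 * k \<le> c + 1))"

lemma zigzag_diff_eq:
  assumes "k \<ge> 1" "c < 4 * k"
  shows "zigzag_diff k g h c = (if even c then zigzag k g h (Suc c mod (4 * k)) - zigzag k g h c
     else zigzag k g h c - zigzag k g h (Suc c mod (4 * k)))"
proof (cases "c = 4 * k - 1")
  case True
  then have "Suc c = 4 * k" "odd c" "c div 2 = 2 * k - 1" "2 * k \<le> c" "3 * k \<le> c" using assms by presburger+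
  then show ?thesis using assms True
    by (simp add: zigzag_def zigzag_diff_def of_nat_diff)
next
  case False
  then have m: "Suc c mod (4 * k) = Suc c" using assms by simp
  \<comment> \<open>\<open>zigzag\<close> branches on the parities of \<open>k\<close> and
    \<open>c\<close>; once both are written out, the halves \<open>c div 2\<close> are explicit and
    linear arithmetic remains.\<close>
  consider (ee) a b where "k = 2 * a" "c = 2 * b" | (eo) a b where "k = 2 * a" "c = 2 * b + 1"
    | (oe) a b where "k = 2 * a + 1" "c = 2 * b" | (oo) a b where "k = 2 * a + 1" "c = 2 * b + 1"
    by (meson evenE oddE)
  then show ?thesis
  proof cases
    case ee then show ?thesis unfolding m using False by (auto simp: zigzag_def zigzag_diff_def)
  next
    case eo then show ?thesis unfolding m using False by (auto simp: zigzag_def zigzag_diff_def)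
  next
    case oe then show ?thesis unfolding m using False by (auto simp: zigzag_def zigzag_diff_def; presburger)
  next
    case oo then show ?thesis unfolding m using False by (auto simp: zigzag_def zigzag_diff_def; presburger)
  qed
qed

text \<open>The even positions climb to \<open>2 * k - 1 + of_bool g\<close>, while the odd ones
  descend only to \<open>2 * k + of_bool g\<close>.\<close>

lemma zigzag_even_less_odd:
  assumes "k \<ge> 1" "c < 4 * k" "c' < 4 * k" "even c" "odd c'"
  shows "zigzag k g h c < zigzag k g h c'"
proof -
  obtain b b' where "c = 2 * b" "c' = 2 * b' + 1" using assms by (meson evenE oddE)
  then show ?thesis using assms by (auto simp: zigzag_def)
qed

lemma zigzag_inj:
  assumes "k \<ge> 1"
  shows "inj_on (zigzag k g h) {..<4 * k}"
proof -
  have even: "zigzag k g h c < zigzag k g h c'" if c: "c < c'" "even c" "even c'" for c c'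
  proof -
    obtain b b' where "c = 2 * b" "c' = 2 * b'" using c by (auto elim!: evenE)
    then show ?thesis using c by (auto simp: zigzag_def)
  qed
  have odd: "zigzag k g h c' < zigzag k g h c" if c: "c < c'" "odd c" "odd c'" for c c'
  proof -
    obtain b b' where "c = 2 * b + 1" "c' = 2 * b' + 1" using c by (auto elim!: oddE)
    then show ?thesis using c by (auto simp: zigzag_def)
  qed
  have "zigzag k g h c \<noteq> zigzag k g h c'" if "c < c'" "c' < 4 * k" for c c'
    using that even odd zigzag_even_less_odd[OF assms]
    by (cases "even c"; cases "even c'") (metis less_irrefl less_trans)+
  then show ?thesis by (intro linorder_inj_onI) auto
qed

lemma zigzag_range:
  assumes "k \<ge> 1" "c < 4 * k"
  shows "0 \<le> zigzag k g h c" "zigzag k g h c < int (4 * k + 1 + 2 * of_bool g + of_bool h)"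
proof -
  obtain b where "c = 2 * b \<or> c = 2 * b + 1" by (meson evenE oddE)
  then show "0 \<le> zigzag k g h c" "zigzag k g h c < int (4 * k + 1 + 2 * of_bool g + of_bool h)"
    using assms by (auto simp: zigzag_def)
qed

text \<open>In the three uses below these are the positive multiples of \<open>s\<close> below
  \<open>S\<close>: none for \<open>s = 4 * k + 1\<close>, the number \<open>2 * k + 1\<close>
  itself, and the first three multiples of \<open>k + 1\<close>.\<close>

definition zigzag_gaps :: "nat \<Rightarrow> bool \<Rightarrow> bool \<Rightarrow> int set" where
  "zigzag_gaps k g h = {d. g \<and> d = int k + 1 \<or> h \<and> d = 2 * int k + of_bool g + 1
     \<or> g \<and> d = 3 * int k + of_bool h + 2}"

lemma zigzag_diff_bij:
  assumes "k \<ge> 1"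
  shows "bij_betw (zigzag_diff k g h) {..<4 * k}
    ({1..<int (4 * k + 1 + 2 * of_bool g + of_bool h)} - zigzag_gaps k g h)"
  unfolding bij_betw_def
proof
  \<comment> \<open>Differences strictly decrease along the path. The closing value
    \<open>2 * k + of_bool g\<close> lies below those of the edges before \<open>2 * k\<close> and
    above those of the remaining ones.\<close>
  have "zigzag_diff k g h c \<noteq> zigzag_diff k g h c'" if "c < c'" "c' < 4 * k" for c c'
    using that by (cases "c' = 4 * k - 1") (auto simp: zigzag_diff_def)
  then show "inj_on (zigzag_diff k g h) {..<4 * k}" by (intro linorder_inj_onI) auto
  show "zigzag_diff k g h ` {..<4 * k}
    = {1..<int (4 * k + 1 + 2 * of_bool g + of_bool h)} - zigzag_gaps k g h" (is "_ = ?B")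
  proof
    show "zigzag_diff k g h ` {..<4 * k} \<subseteq> ?B"
    proof (rule image_subsetI)
      fix c assume "c \<in> {..<4 * k}"
      then consider "c = 4 * k - 1" | "c \<noteq> 4 * k - 1" "c < k" | "c \<noteq> 4 * k - 1" "k \<le> c" "c < 2 * k"
        | "c \<noteq> 4 * k - 1" "2 * k \<le> c" "c + 1 < 3 * k" | "c < 4 * k - 1" "2 * k \<le> c" "3 * k \<le> c + 1"
        by fastforce
      then show "zigzag_diff k g h c \<in> ?B"
      proof cases
        case 1 then show ?thesis using assms by (cases g; cases h; simp add: zigzag_diff_def zigzag_gaps_def)
      next
        case 2 then show ?thesis using assms by (cases g; cases h; simp add: zigzag_diff_def zigzag_gaps_def)
      next
        case 3 then show ?thesis using assms by (cases g; cases h; simp add: zigzag_diff_def zigzag_gaps_def)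
      next
        case 4 then show ?thesis using assms by (cases g; cases h; simp add: zigzag_diff_def zigzag_gaps_def)
      next
        case 5 then show ?thesis using assms by (cases g; cases h; simp add: zigzag_diff_def zigzag_gaps_def)
      qed
    qed
    show "?B \<subseteq> zigzag_diff k g h ` {..<4 * k}"
    proof
      fix d assume d: "d \<in> ?B"
      obtain c where "zigzag_diff k g h c = d" "c < 4 * k"
      proof -
        \<comment> \<open>Between gaps the difference is an affine function of \<open>c\<close> with
          slope -1, so each range of \<open>d\<close> has an explicit preimage.\<close>
        consider (closing) "d = 2 * int k + of_bool g"
          | (upper) "2 * int k + of_bool g < d" "g \<longrightarrow> 3 * int k + of_bool h + 1 < d"
          | (upper_mid) "2 * int k + of_bool g < d" g "d \<le> 3 * int k + of_bool h + 1"
          | (lower_mid) "d < 2 * int k + of_bool g" "g \<longrightarrow> int k < d"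
          | (lower) "d < 2 * int k + of_bool g" g "d \<le> int k"
          by linarith
        then show ?thesis
        proof cases
        case closing
        then show ?thesis using assms by (intro that[of "4 * k - 1"]) (auto simp: zigzag_diff_def)
      next
        case upper
        define c where "c = nat (int (4 * k + 2 * of_bool g + of_bool h) - d)"
        have "int c = int (4 * k + 2 * of_bool g + of_bool h) - d" using upper d assms
          by (cases g; cases h; simp add: c_def zigzag_gaps_def)
        then have "zigzag_diff k g h c = d" "c < 4 * k" using upper d assms
          by (cases g; cases h; simp add: zigzag_diff_def zigzag_gaps_def)+
        then show ?thesis by (rule that)

      next
        case upper_mid
        define c where "c = nat (int (4 * k + 2 * of_bool g + of_bool h) - d - 1)"
        have "int c = int (4 * k + 2 * of_bool g + of_bool h) - d - 1" using upper_mid d assms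
          by (cases g; cases h; simp add: c_def zigzag_gaps_def)
        then have "zigzag_diff k g h c = d" "c < 4 * k" using upper_mid d assms
          by (cases g; cases h; simp add: zigzag_diff_def zigzag_gaps_def)+
        then show ?thesis by (rule that)

      next
        case lower_mid
        define c where "c = nat (int (4 * k + 2 * of_bool g + of_bool h) - d - of_bool g - of_bool h - 1)"
        have "int c = int (4 * k + 2 * of_bool g + of_bool h) - d - of_bool g - of_bool h - 1" using lower_mid d assms
          by (cases g; cases h; simp add: c_def zigzag_gaps_def)
        then have "zigzag_diff k g h c = d" "c < 4 * k" using lower_mid d assms
          by (cases g; cases h; simp add: zigzag_diff_def zigzag_gaps_def)+
        then show ?thesis by (rule that)

      next
        case lower
        define c where "c = nat (int (4 * k + 2 * of_bool g + of_bool h) - d - of_bool h - 3)"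
        have "int c = int (4 * k + 2 * of_bool g + of_bool h) - d - of_bool h - 3" using lower d assms
          by (cases g; cases h; simp add: c_def zigzag_gaps_def)
        then have "zigzag_diff k g h c = d" "c < 4 * k" using lower d assms
          by (cases g; cases h; simp add: zigzag_diff_def zigzag_gaps_def)+
        then show ?thesis by (rule that)
        qed
      qed
      then show "d \<in> zigzag_diff k g h ` {..<4 * k}" by auto
    qed
  qed
qed

section \<open>The three families of multipartite graphs\<close>

lemma cyclic_decomposition_cylinder_zigzag:
  fixes k m n s t :: nat and g h :: bool
  defines "S \<equiv> int (4 * k + 1 + 2 * of_bool g + of_bool h)"
  assumes "k \<ge> 1" "m \<ge> 1" "n \<ge> 1" "s > 0"
    and dvd: "int s dvd S"
    and gaps: "\<And>d. 0 < d \<Longrightarrow> d < S \<Longrightarrow> d \<in> zigzag_gaps k g h \<longleftrightarrow> int s dvd d"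
    and order: "s * t = (4 * k + 1 + 2 * of_bool g + of_bool h) * (2 * (2 * m - 1) * n)"
  shows "\<exists>\<B>. is_cyclic_decomposition (cylinder (4 * k) m) (complete_multipartite s t) \<B>"
proof (rule cyclic_decomposition_cylinder[OF _ _ _ _ _ _ _ _ _ dvd])
  have "int (2 * m - 1) = 2 * int m - 1" using \<open>m \<ge> 1\<close> by simp
  then show "int (s * t) = 2 * ((2 * int m - 1) * S) * int n"
    unfolding order S_def by (simp only: of_nat_mult mult_ac of_nat_numeral)
  show "inj_on (zigzag k g h) {..<4 * k}" by (rule zigzag_inj) fact
  show "zigzag k g h c \<in> {0..<S}" if "c < 4 * k" for c
    using zigzag_range[OF \<open>k \<ge> 1\<close> that] by (simp add: S_def)
  show "zigzag_diff k g h c = (if even c then zigzag k g h (Suc c mod (4 * k)) - zigzag k g h c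
      else zigzag k g h c - zigzag k g h (Suc c mod (4 * k)))" if "c < 4 * k" for c
    by (rule zigzag_diff_eq) fact+
  have "{1..<S} - zigzag_gaps k g h = {d \<in> {1..<S}. \<not> int s dvd d}" using gaps by auto
  then show "bij_betw (zigzag_diff k g h) {..<4 * k} {d \<in> {1..<S}. \<not> int s dvd d}"
    using zigzag_diff_bij[OF \<open>k \<ge> 1\<close>, of g h] by (simp add: S_def)
qed (use assms in simp_all)

theorem proposition3p6:
  fixes k n m :: nat
  assumes "k \<ge> 1" and "n \<ge> 1" and "m > 2"
  shows "(\<exists>\<B>. is_cyclic_decomposition (cylinder (4 * k) m)
              (complete_multipartite (4 * k + 1) (2 * (2 * m - 1) * n)) \<B>) \<and>
         (\<exists>\<B>. is_cyclic_decomposition (cylinder (4 * k) m)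
              (complete_multipartite (2 * k + 1) (4 * (2 * m - 1) * n)) \<B>) \<and>
         (\<exists>\<B>. is_cyclic_decomposition (cylinder (4 * k) m)
              (complete_multipartite (k + 1) (8 * (2 * m - 1) * n)) \<B>)"
proof (intro conjI)
  \<comment> \<open>Used with \<open>u\<close> equal to \<open>S div s\<close>, that is 1, 2 and 4,
    to list the multiples that the gaps must match.\<close>
  have multiples: "int s dvd d \<longleftrightarrow> (\<exists>q\<in>{1..<u}. d = int s * q)" if "0 < d" "d < int s * u" for s d u
  proof
    assume "int s dvd d"
    then obtain q where q: "d = int s * q" ..
    with that have "0 < int s * q" "int s * q < int s * u" by simp_all
    then have "0 < q" "q < u" by (simp_all add: zero_less_mult_iff)
    with q show "\<exists>q\<in>{1..<u}. d = int s * q" by auto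
  qed auto
  have upto: "{1..<1} = ({} :: int set)" "{1..<2} = {1 :: int}" "{1..<4} = {1, 2, 3 :: int}" by auto
  show "\<exists>\<B>. is_cyclic_decomposition (cylinder (4 * k) m)
      (complete_multipartite (4 * k + 1) (2 * (2 * m - 1) * n)) \<B>"
  proof (rule cyclic_decomposition_cylinder_zigzag[of k m n _ False False])
    \<comment> \<open>Here \<open>S\<close> equals \<open>s\<close>, so nothing is skipped.\<close>
    show "d \<in> zigzag_gaps k False False \<longleftrightarrow> int (4 * k + 1) dvd d"
      if "0 < d" "d < int (4 * k + 1 + 2 * of_bool False + of_bool False)" for d
      using multiples[of d "4 * k + 1" 1] that unfolding upto by (auto simp: zigzag_gaps_def)
    \<comment> \<open>The variable \<open>x\<close> stands for \<open>2 * m - 1\<close> and keeps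
      the truncated subtraction out of the algebra.\<close>
    have "(4 * k + 1) * (2 * x * n) = (4 * k + 1 + 2 * of_bool False + of_bool False) * (2 * x * n)" for x
      by (simp add: algebra_simps)
    then show "(4 * k + 1) * (2 * (2 * m - 1) * n)
      = (4 * k + 1 + 2 * of_bool False + of_bool False) * (2 * (2 * m - 1) * n)" .
  qed (use assms in simp_all)
  show "\<exists>\<B>. is_cyclic_decomposition (cylinder (4 * k) m)
      (complete_multipartite (2 * k + 1) (4 * (2 * m - 1) * n)) \<B>"
  proof (rule cyclic_decomposition_cylinder_zigzag[of k m n _ False True])
    show "int (2 * k + 1) dvd int (4 * k + 1 + 2 * of_bool False + of_bool True)"
      by (rule dvdI[of _ _ 2]) simp
    \<comment> \<open>Here \<open>S\<close> is twice \<open>s\<close>, and the middle gap is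
      \<open>s\<close>.\<close>
    show "d \<in> zigzag_gaps k False True \<longleftrightarrow> int (2 * k + 1) dvd d"
      if "0 < d" "d < int (4 * k + 1 + 2 * of_bool False + of_bool True)" for d
      using multiples[of d "2 * k + 1" 2] that unfolding upto by (auto simp: zigzag_gaps_def)
    have "(2 * k + 1) * (4 * x * n) = (4 * k + 1 + 2 * of_bool False + of_bool True) * (2 * x * n)" for x
      by (simp add: algebra_simps)
    then show "(2 * k + 1) * (4 * (2 * m - 1) * n)
      = (4 * k + 1 + 2 * of_bool False + of_bool True) * (2 * (2 * m - 1) * n)" .
  qed (use assms in simp_all)
  show "\<exists>\<B>. is_cyclic_decomposition (cylinder (4 * k) m)
      (complete_multipartite (k + 1) (8 * (2 * m - 1) * n)) \<B>"
  proof (rule cyclic_decomposition_cylinder_zigzag[of k m n _ True True])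
    show "int (k + 1) dvd int (4 * k + 1 + 2 * of_bool True + of_bool True)"
      by (rule dvdI[of _ _ 4]) simp
    \<comment> \<open>Here \<open>S\<close> is four times \<open>s\<close>; the three gaps are
      \<open>s\<close>, \<open>2 * s\<close> and \<open>3 * s\<close>.\<close>
    show "d \<in> zigzag_gaps k True True \<longleftrightarrow> int (k + 1) dvd d"
      if "0 < d" "d < int (4 * k + 1 + 2 * of_bool True + of_bool True)" for d
      using multiples[of d "k + 1" 4] that unfolding upto by (auto simp: zigzag_gaps_def)
    have "(k + 1) * (8 * x * n) = (4 * k + 1 + 2 * of_bool True + of_bool True) * (2 * x * n)" for x
      by (simp add: algebra_simps)
    then show "(k + 1) * (8 * (2 * m - 1) * n)
      = (4 * k + 1 + 2 * of_bool True + of_bool True) * (2 * (2 * m - 1) * n)" .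
  qed (use assms in simp_all)
qed

end
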